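(* Let $a,k,d,e$ be integers with $1\le a\le k$, $1\le d\le k$, and either $e=d$ or $2e=d$. Let ${}_d\overline{B}_{dk+e,\,da}(n)$ be the number of partitions of $n$ such that $$\phi_i+\phi_{i+1}<dk+e\ \text{ for all } i\ge1,\qquad \phi_1<da,\qquad d\mid\phi_{2i+1}\ \text{ for all } i\ge 0.$$ Then $$\sum_{n\ge0}{}_d\overline{B}_{dk+e,\,da}(n)\,q^n=\frac{(q^{da},q^{2dk-da+2e+d},q^{2dk+2e+d};q^{2dk+2e+d})_\infty}{(q^{d};q^{2d})_\infty\,(q^2;q^2)_\infty}.$$
   Context: A partition of a nonnegative integer $n$ is a finite non-increasing sequence of positive integers summing to $n$ (the empty partition is the unique partition of $0$). For a partition and an integer $i\ge1$, $\phi_i$ denotes the number of times $i$ occurs as a part. For $|q|<1$: $(a;q)_n=(1-a)(1-aq)\cdots(1-aq^{n-1})$, $(a;q)_\infty=\lim_{n\to\infty}(a;q)_n$, and $(a_1,\dots,a_r;q)_\infty=(a_1;q)_\infty\cdots(a_r;q)_\infty$. The identity is of formal power series in $q$. *)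

theory Defs
  imports "HOL-Computational_Algebra.Formal_Power_Series"
begin

definition partitions_of :: "nat \<Rightarrow> nat list set" where
  "partitions_of n = {xs. sorted_wrt (\<ge>) xs \<and> (\<forall>x\<in>set xs. 0 < x) \<and> sum_list xs = n}"

definition phi :: "nat list \<Rightarrow> nat \<Rightarrow> nat" where
  "phi xs i = count_list xs i"

definition dB_set :: "nat \<Rightarrow> nat \<Rightarrow> nat \<Rightarrow> nat \<Rightarrow> nat \<Rightarrow> nat list set" where
  "dB_set d k e a n = {xs \<in> partitions_of n.
      (\<forall>i\<ge>1. phi xs i + phi xs (i + 1) < d * k + e) \<and>
      phi xs 1 < d * a \<and>
      (\<forall>i. d dvd phi xs (2 * i + 1))}"

definition dB :: "nat \<Rightarrow> nat \<Rightarrow> nat \<Rightarrow> nat \<Rightarrow> nat \<Rightarrow> nat" where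
  "dB d k e a n = card (dB_set d k e a n)"

text \<open>Infinite q-Pochhammer symbol (x;y)_\<infinity> of formal power series, as the limit
  of the finite products in the standard (X-adic) metric on formal power series.\<close>
definition fps_qpoch_inf :: "'a::field fps \<Rightarrow> 'a fps \<Rightarrow> 'a fps" where
  "fps_qpoch_inf x y = lim (\<lambda>N. \<Prod>j<N. (1 - x * y ^ j))"

end

theory Submission
  imports Defs
begin

text \<open>
  With \<open>K = dk + e\<close>, let \<open>G\<^sub>N(b)\<close> count the partitions as in the theorem, all of whose parts exceed
  \<open>N\<close> and with \<open>\<phi>\<close> of \<open>N + 1\<close> less than \<open>b\<close>. Removing the parts equal to \<open>N + 1\<close> gives
  recurrences that express \<open>G\<^sub>N\<close> through \<open>G\<close> at \<open>N + 1\<close>; they close up on the values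
  \<open>b \<equiv> 0 (mod d)\<close> for even \<open>N\<close> and \<open>b \<equiv> K (mod d)\<close> for odd \<open>N\<close>. Multiplied by the generating
  function denominators, the same recurrences hold for an explicit alternating series (Andrews' series
  for Gordon's theorem at \<open>x = q\<^sup>N\<close>, with \<open>(x\<^sup>dq\<^sup>d;q\<^sup>d)\<^sub>n / (q\<^sup>d;q\<^sup>d)\<^sub>n\<close> as coefficients).
  Both sides are \<open>1\<close> modulo \<open>q\<close> to the power \<open>N + 1\<close>, so they agree by descending induction on
  \<open>N\<close>. At \<open>N = 0\<close> the series is a theta series, which the Jacobi triple product evaluates.
  Everything is done modulo \<open>q\<^sup>M\<close> for arbitrary \<open>M\<close>, so that only finite sums and products occur.
\<close>

unbundle fps_syntax

section \<open>Congruence of power series modulo a power of the variable\<close>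

definition fps_cong :: "nat \<Rightarrow> 'a::field fps \<Rightarrow> 'a fps \<Rightarrow> bool" where
  "fps_cong M f g \<longleftrightarrow> fps_X ^ M dvd f - g"

lemma fps_cong_refl [simp, intro]: "fps_cong M f f"
  by (simp add: fps_cong_def)

lemma fps_cong_sym: "fps_cong M f g \<Longrightarrow> fps_cong M g f"
  unfolding fps_cong_def by (metis dvd_minus_iff minus_diff_eq)

lemma fps_cong_trans [trans]: "fps_cong M f g \<Longrightarrow> fps_cong M g h \<Longrightarrow> fps_cong M f h"
  unfolding fps_cong_def using dvd_add [of "fps_X ^ M" "f - g" "g - h"] by simp

lemma fps_cong_eq_trans [trans]:
  "fps_cong M f g \<Longrightarrow> g = h \<Longrightarrow> fps_cong M f h"
  "f = g \<Longrightarrow> fps_cong M g h \<Longrightarrow> fps_cong M f h"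
  by auto

lemma fps_cong_add: "fps_cong M f g \<Longrightarrow> fps_cong M f' g' \<Longrightarrow> fps_cong M (f + f') (g + g')"
  unfolding fps_cong_def by (metis dvd_add add_diff_add)

lemma fps_cong_diff: "fps_cong M f g \<Longrightarrow> fps_cong M f' g' \<Longrightarrow> fps_cong M (f - f') (g - g')"
  unfolding fps_cong_def using dvd_diff [of "fps_X ^ M" "f - g" "f' - g'"] by (simp add: algebra_simps)

lemma fps_cong_mult: "fps_cong M f g \<Longrightarrow> fps_cong M f' g' \<Longrightarrow> fps_cong M (f * f') (g * g')"
  unfolding fps_cong_def by (simp add: mult_diff_mult dvd_add)

lemma fps_cong_sum:
  "(\<And>i. i \<in> A \<Longrightarrow> fps_cong M (f i) (g i)) \<Longrightarrow> fps_cong M (sum f A) (sum g A)"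
  by (induction A rule: infinite_finite_induct) (auto intro: fps_cong_add)

lemma fps_cong_prod:
  "(\<And>i. i \<in> A \<Longrightarrow> fps_cong M (f i) (g i)) \<Longrightarrow> fps_cong M (prod f A) (prod g A)"
  by (induction A rule: infinite_finite_induct) (auto intro: fps_cong_mult)

lemma fps_cong_0I: "fps_X ^ M dvd f \<Longrightarrow> fps_cong M f 0"
  by (simp add: fps_cong_def)

lemma fps_cong_X_power_0: "M \<le> p \<Longrightarrow> fps_cong M (fps_X ^ p) 0"
  by (rule fps_cong_0I) (rule le_imp_power_dvd)

text \<open>A series with nonzero constant term is a unit, so multiplying by its inverse removes it
  from both sides.\<close>

lemma fps_cong_mult_cancel:
  assumes "f $ 0 \<noteq> 0" "fps_cong M (f * g) (f * h)"
  shows "fps_cong M g h"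
proof -
  have "fps_cong M (inverse f * (f * g)) (inverse f * (f * h))"
    by (rule fps_cong_mult [OF fps_cong_refl assms(2)])
  then show ?thesis
    unfolding mult.assoc [symmetric] inverse_mult_eq_1 [OF assms(1)] by simp
qed

lemma X_power_dvd_iff_nth: "fps_X ^ M dvd f \<longleftrightarrow> (\<forall>i<M. f $ i = 0)"
proof
  assume "fps_X ^ M dvd f"
  then show "\<forall>i<M. f $ i = 0"
    by (auto elim!: dvdE simp: fps_X_power_mult_nth)
next
  assume "\<forall>i<M. f $ i = 0"
  then have "f = fps_X ^ M * fps_shift M f"
    by (auto simp: fps_eq_iff fps_X_power_mult_nth)
  then show "fps_X ^ M dvd f" by (metis dvd_triv_left)
qed

lemma fps_cong_iff_nth: "fps_cong M f g \<longleftrightarrow> (\<forall>i<M. f $ i = g $ i)"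
  by (simp add: fps_cong_def X_power_dvd_iff_nth)

text \<open>Through this rule the final identity follows from finite computations modulo each power
  of the variable.\<close>

lemma fps_eqI_cong: "(\<And>M. fps_cong M f g) \<Longrightarrow> f = g"
  by (rule fps_ext) (auto simp: fps_cong_iff_nth)

section \<open>The finite Jacobi triple product\<close>

lemma Suc_choose_2: "Suc n choose 2 = (n choose 2) + n"
  by (simp add: numeral_2_eq_2)

section \<open>Finite q-Pochhammer products and q-binomial coefficients\<close>

definition qpoch :: "'a::comm_ring_1 \<Rightarrow> 'a \<Rightarrow> nat \<Rightarrow> 'a" where
  "qpoch x y n = (\<Prod>j<n. 1 - x * y ^ j)"

lemma qpoch_0 [simp]: "qpoch x y 0 = 1"
  by (simp add: qpoch_def)

lemma qpoch_Suc: "qpoch x y (Suc n) = qpoch x y n * (1 - x * y ^ n)"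
  by (simp add: qpoch_def)

text \<open>The Pascal recurrence defines Gaussian binomials without division, hence over any
  commutative ring; \<open>qbinomial_qpoch\<close> gives the link to the usual quotient.\<close>

fun qbinomial :: "'a::comm_ring_1 \<Rightarrow> nat \<Rightarrow> nat \<Rightarrow> 'a" where
  "qbinomial q n 0 = 1"
| "qbinomial q 0 (Suc k) = 0"
| "qbinomial q (Suc n) (Suc k) = qbinomial q n (Suc k) + q ^ (n - k) * qbinomial q n k"

lemma qbinomial_eq_0: "n < k \<Longrightarrow> qbinomial q n k = 0"
  by (induction q n k rule: qbinomial.induct) auto

lemma qbinomial_qpoch:
  "k \<le> n \<Longrightarrow> qbinomial q n k * qpoch q q k * qpoch q q (n - k) = qpoch q q n"
proof (induction q n k rule: qbinomial.induct)
  case (3 q n k)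
  show ?case
  proof (cases "k = n")
    case True
    then show ?thesis
      using 3 by (simp add: qbinomial_eq_0 qpoch_Suc) (simp add: mult.assoc [symmetric])
  next
    case False
    with 3 have "k < n" by simp
    then obtain l where l: "n = Suc (k + l)"
      using less_iff_Suc_add by auto
    define A where "A = qpoch q q n"
    have 1: "qbinomial q n (Suc k) * qpoch q q (Suc k) * qpoch q q l = A"
      using 3(1) l by (simp add: A_def)
    have 2: "qbinomial q n k * qpoch q q k * qpoch q q (Suc l) = A"
      using 3(2) l by (simp add: A_def)
    \<comment> \<open>After Pascal's rule both summands contain \<open>A\<close>, and (1 - q^(l+1))
      + q^(l+1) (1 - q^(k+1)) = 1 - q^(l+k+2).\<close>
    have "qbinomial q (Suc n) (Suc k) * qpoch q q (Suc k) * qpoch q q (Suc l)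
        = (qbinomial q n (Suc k) * qpoch q q (Suc k) * qpoch q q l) * (1 - q ^ Suc l)
          + q ^ Suc l * (qbinomial q n k * qpoch q q k * qpoch q q (Suc l)) * (1 - q ^ Suc k)"
      using l by (simp add: qpoch_Suc algebra_simps)
    also have "\<dots> = A * (1 - q ^ (Suc l + Suc k))"
      unfolding 1 2 by (simp add: algebra_simps power_add)
    also have "Suc l + Suc k = Suc n"
      using l by simp
    finally show ?thesis
      using l by (simp add: A_def qpoch_Suc)
  qed
qed auto

text \<open>Pascal's rule splits the sum for n + 1 into u and y q^n times the sum for n. The
  homogeneous form allows \<open>u\<close> to be a power of q later, which centres the
  product.\<close>

lemma qbinomial_theorem:
  "(\<Prod>i<n. u + y * q ^ i) =
    (\<Sum>k\<le>n. q ^ (k choose 2) * qbinomial q n k * y ^ k * u ^ (n - k))"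
proof (induction n)
  case (Suc n)
  let ?t = "\<lambda>k. q ^ (k choose 2) * qbinomial q n k * y ^ k * u ^ (n - k)"
  have "(\<Sum>k\<le>Suc n. q ^ (k choose 2) * qbinomial q (Suc n) k * y ^ k * u ^ (Suc n - k))
      = u ^ Suc n + (\<Sum>k\<le>n. q ^ (Suc k choose 2) * qbinomial q (Suc n) (Suc k)
          * y ^ Suc k * u ^ (n - k))"
    by (subst sum.atMost_Suc_shift) (simp add: numeral_2_eq_2)
  also have "(\<Sum>k\<le>n. q ^ (Suc k choose 2) * qbinomial q (Suc n) (Suc k) * y ^ Suc k * u ^ (n - k))
      = (\<Sum>k\<le>n. q ^ (Suc k choose 2) * qbinomial q n (Suc k) * y ^ Suc k * u ^ (n - k))
        + (\<Sum>k\<le>n. y * q ^ n * ?t k)"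
    unfolding sum.distrib [symmetric]
  proof (rule sum.cong)
    fix k assume "k \<in> {..n}"
    \<comment> \<open>The Pascal weight q^(n-k) and the q^k from the growth of k choose 2 combine to
      q^n, independent of k.\<close>
    then have "q ^ n = q ^ k * q ^ (n - k)"
      by (simp add: power_add [symmetric])
    then show "q ^ (Suc k choose 2) * qbinomial q (Suc n) (Suc k) * y ^ Suc k * u ^ (n - k)
      = q ^ (Suc k choose 2) * qbinomial q n (Suc k) * y ^ Suc k * u ^ (n - k) + y * q ^ n * ?t k"
      by (simp add: Suc_choose_2 power_add algebra_simps)
  qed simp
  also have "u ^ Suc n + ((\<Sum>k\<le>n. q ^ (Suc k choose 2) * qbinomial q n (Suc k) * y ^ Suc k * u ^ (n - k))
        + (\<Sum>k\<le>n. y * q ^ n * ?t k))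
      = (\<Sum>k\<le>Suc n. q ^ (k choose 2) * qbinomial q n k * y ^ k * u ^ (Suc n - k))
        + (\<Sum>k\<le>n. y * q ^ n * ?t k)"
    by (subst sum.atMost_Suc_shift) (simp add: numeral_2_eq_2)
  also have "(\<Sum>k\<le>Suc n. q ^ (k choose 2) * qbinomial q n k * y ^ k * u ^ (Suc n - k))
      = (\<Sum>k\<le>n. u * ?t k)"
    by (simp add: qbinomial_eq_0 Suc_diff_le algebra_simps)
  also have "(\<Sum>k\<le>n. u * ?t k) + (\<Sum>k\<le>n. y * q ^ n * ?t k) = (\<Prod>i<Suc n. u + y * q ^ i)"
    using Suc by (simp add: sum_distrib_left [symmetric] algebra_simps)
  finally show ?case ..
qed (simp add: numeral_2_eq_2)

section \<open>Truncations of infinite products\<close>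

lemma fps_X_power_nth_0 [simp]: "0 < p \<Longrightarrow> (fps_X ^ p) $ 0 = 0"
  by (simp add: fps_X_power_nth)

lemma qpoch_X_power_nth_0:
  assumes "0 < p"
  shows "qpoch (fps_X ^ p) y n $ 0 = (1 :: 'a::field)"
  using assms by (induction n) (simp_all add: qpoch_Suc)

text \<open>The factor of index j >= M is 1 minus a power with exponent p + r j >= M, so it is 1
  modulo X^M.\<close>

lemma qpoch_X_power_cong:
  assumes "0 < p" "0 < r" "M \<le> n"
  shows "fps_cong M (qpoch (fps_X ^ p) (fps_X ^ r) n) (qpoch (fps_X ^ p) (fps_X ^ r) M :: 'a::field fps)"
  using assms(3)
proof (induction n rule: dec_induct)
  case (step n)
  have "1 * n \<le> r * n"
    using assms(2) by (intro mult_le_mono1) simp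
  then have "M \<le> p + r * n"
    using step by linarith
  then have "fps_cong M (qpoch (fps_X ^ p) (fps_X ^ r) n * (1 - fps_X ^ (p + r * n)))
      (qpoch (fps_X ^ p) (fps_X ^ r) M * (1 - 0 :: 'a fps))"
    using step by (intro fps_cong_mult fps_cong_diff fps_cong_X_power_0) auto
  then show ?case by (simp add: qpoch_Suc power_add power_mult)
qed auto

lemma fps_qpoch_inf_cong:
  assumes "0 < p" "0 < r" "M \<le> n"
  shows "fps_cong M (fps_qpoch_inf (fps_X ^ p) (fps_X ^ r)) (qpoch (fps_X ^ p) (fps_X ^ r) n :: 'a::field fps)"
proof -
  define P where "P n = (qpoch (fps_X ^ p) (fps_X ^ r) n :: 'a fps)" for n
  \<comment> \<open>The coefficient of index i is constant once more than i factors are present, so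
    the diagonal coefficients form the limit.\<close>
  define F where "F = Abs_fps (\<lambda>i. P (Suc i) $ i)"
  have P: "fps_cong M (P n) (P M)" if "M \<le> n" for M n
    unfolding P_def using assms(1,2) that by (rule qpoch_X_power_cong)
  have nth: "P n $ i = F $ i" if "i < n" for i n
    using P [of "Suc i" n] that by (simp add: F_def fps_cong_iff_nth)
  have "P \<longlonglongrightarrow> F"
  proof (rule tendsto_fpsI)
    show "\<forall>\<^sub>F n in sequentially. P n $ i = F $ i" for i
      using eventually_gt_at_top [of i] by eventually_elim (rule nth)
  qed
  then have "fps_qpoch_inf (fps_X ^ p) (fps_X ^ r) = F"
    unfolding fps_qpoch_inf_def P_def qpoch_def by (rule limI)
  then show ?thesis
    using nth assms(3) by (simp add: fps_cong_iff_nth flip: P_def)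
qed


section \<open>The triple product from the q-binomial theorem\<close>

lemma choose_2_add: "(i + j) choose 2 = (i choose 2) + (j choose 2) + i * j"
  by (induction j) (simp_all add: Suc_choose_2 numeral_2_eq_2)

lemma square_eq_choose_2: "n * n = 2 * (n choose 2) + n"
  by (induction n) (simp_all add: Suc_choose_2)

lemma prod_power_lessThan: "(\<Prod>j<n. q ^ j) = q ^ (n choose 2)" for q :: "'a::comm_monoid_mult"
  by (induction n) (simp_all add: Suc_choose_2 power_add mult.commute binomial_eq_0)

lemma prod_lessThan_add: "(\<Prod>i<n + l. f i) = (\<Prod>i<n. f i) * (\<Prod>i<l. f (n + i))"
  for f :: "nat \<Rightarrow> 'a::comm_monoid_mult"
  by (induction l) (simp_all add: mult.assoc)

lemma sum_atMost_double:
  "(\<Sum>i\<le>n + n. f i) = (\<Sum>j\<le>n. f (n - j)) + (\<Sum>j<n. f (Suc (n + j)))"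
  for f :: "nat \<Rightarrow> 'a::comm_monoid_add"
proof -
  have "(\<Sum>i<Suc n + l. f i) = (\<Sum>i<Suc n. f i) + (\<Sum>i<l. f (Suc n + i))" for l
    by (induction l) (simp_all add: ac_simps)
  from this [of n] show ?thesis
    using sum.nat_diff_reindex [of f "Suc n"] by (simp add: lessThan_Suc_atMost)
qed

text \<open>The q-binomial theorem with \<open>u = x\<close> to the power \<open>mn\<close> and \<open>y = - x\<^sup>b\<close>, divided by the
  common monomial \<open>C\<close>.\<close>

lemma finite_jacobi_triple_product:
  fixes x :: "'a::idom"
  assumes "x \<noteq> 0" "b \<le> m"
  shows "qpoch (x ^ b) (x ^ m) n * qpoch (x ^ (m - b)) (x ^ m) n =
    (\<Sum>j\<le>n. (-1) ^ j * x ^ (m * (j choose 2) + (m - b) * j) * qbinomial (x ^ m) (n + n) (n - j))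
    - (\<Sum>j<n. (-1) ^ j * x ^ (m * (j choose 2) + (m + b) * j + b)
         * qbinomial (x ^ m) (n + n) (Suc (n + j)))"
    (is "?P = ?S")
proof -
  define q where "q = x ^ m"
  define C where "C = (-1) ^ n * x ^ (b * n) * q ^ ((n choose 2) + n * n)"
  have "C \<noteq> 0"
    using assms(1) by (simp add: C_def q_def)
  \<comment> \<open>With i = n - 1 - j, the monomial -(x^b) q^i is taken out of the factor of index
    i, leaving 1 - x^(m-b) q^j.\<close>
  have low: "q ^ n + (- (x ^ b)) * q ^ (n - Suc j)
      = - (x ^ b) * q ^ (n - Suc j) * (1 - x ^ (m - b) * q ^ j)" if "j < n" for j
  proof -
    have "x ^ b * q ^ (n - Suc j) * (x ^ (m - b) * q ^ j) = (x ^ b * x ^ (m - b)) * (q ^ (n - Suc j) * q ^ j)"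
      by simp
    also have "\<dots> = q * (q ^ (n - Suc j) * q ^ j)"
      using assms(2) by (simp add: q_def flip: power_add)
    also have "\<dots> = q ^ n"
      using that by (simp flip: power_add power_Suc)
    finally show ?thesis by (simp add: algebra_simps)
  qed
  \<comment> \<open>The lower n factors, read backwards, build the Pochhammer product of x^(m-b),
    the upper n factors that of x^b.\<close>
  have "(\<Prod>i<n + n. q ^ n + (- (x ^ b)) * q ^ i)
      = (\<Prod>j<n. q ^ n + (- (x ^ b)) * q ^ (n - Suc j)) * (\<Prod>j<n. q ^ n * (1 - x ^ b * q ^ j))"
    unfolding prod_lessThan_add
    by (subst (2) prod.nat_diff_reindex [symmetric]) (simp add: power_add algebra_simps)
  also have "(\<Prod>j<n. q ^ n + (- (x ^ b)) * q ^ (n - Suc j))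
      = (\<Prod>j<n. (- (x ^ b)) * q ^ (n - Suc j) * (1 - x ^ (m - b) * q ^ j))"
    by (intro prod.cong refl low) simp
  also have "\<dots> = (- (x ^ b)) ^ n * q ^ (n choose 2) * qpoch (x ^ (m - b)) q n"
    unfolding prod.distrib prod_power_lessThan [symmetric]
    by (subst prod.nat_diff_reindex) (simp add: qpoch_def)
  also have "(\<Prod>j<n. q ^ n * (1 - x ^ b * q ^ j)) = q ^ (n * n) * qpoch (x ^ b) q n"
    by (simp add: prod.distrib qpoch_def power_mult)
  also have "(- (x ^ b)) ^ n * q ^ (n choose 2) * qpoch (x ^ (m - b)) q n * (q ^ (n * n) * qpoch (x ^ b) q n)
      = C * ?P"
    by (simp add: C_def power_minus [of "x ^ b"] power_mult power_add q_def)
  finally have lhs: "(\<Prod>i<n + n. q ^ n + (- (x ^ b)) * q ^ i) = C * ?P" .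
  let ?t = "\<lambda>k. q ^ (k choose 2) * qbinomial q (n + n) k * (- (x ^ b)) ^ k * (q ^ n) ^ (n + n - k)"
  have t1: "?t (n - j) = C * ((-1) ^ j * x ^ (m * (j choose 2) + (m - b) * j) * qbinomial q (n + n) (n - j))"
    if j: "j \<le> n" for j
  proof -
    obtain i where i: "n = i + j"
      using le_Suc_ex [OF j] by (auto simp: add.commute)
    have e: "(i choose 2) + n * (n + j) = ((n choose 2) + n * n) + ((j choose 2) + j)"
      unfolding i choose_2_add using square_eq_choose_2 [of j] by (simp add: algebra_simps)
    \<comment> \<open>Compared with \<open>C\<close>, a factor x^(-b j) is left over; merging it
      with q^j = x^(m j) into x^((m-b) j) avoids negative exponents.\<close>
    have x: "q ^ j * x ^ (b * i) = x ^ (b * n) * x ^ ((m - b) * j)"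
      using le_Suc_ex [OF assms(2)] by (auto simp: q_def i algebra_simps simp flip: power_add power_mult)
    have sgn: "(-1 :: 'a) ^ i = (-1) ^ n * (-1) ^ j"
      by (simp add: i power_add mult.assoc flip: power_mult_distrib)
    have q: "q ^ (i choose 2) * (q ^ n) ^ (n + j) = q ^ ((n choose 2) + n * n) * (q ^ (j choose 2) * q ^ j)"
      using e by (simp flip: power_add power_mult)
    have "?t (n - j) = (q ^ (i choose 2) * (q ^ n) ^ (n + j)) * (-1) ^ i * x ^ (b * i) * qbinomial q (n + n) (n - j)"
      by (simp add: i power_minus [of "x ^ b"] power_mult add_ac)
    also have "\<dots> = q ^ ((n choose 2) + n * n) * q ^ (j choose 2) * ((-1) ^ n * (-1) ^ j)
        * (q ^ j * x ^ (b * i)) * qbinomial q (n + n) (n - j)"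
      unfolding q sgn by (simp only: mult_ac)
    also have "\<dots> = C * ((-1) ^ j * x ^ (m * (j choose 2) + (m - b) * j) * qbinomial q (n + n) (n - j))"
      unfolding x unfolding C_def power_add power_mult q_def by (simp only: mult_ac)
    finally show ?thesis .
  qed
  have t2: "?t (Suc (n + j)) = - (C * ((-1) ^ j * x ^ (m * (j choose 2) + (m + b) * j + b)
      * qbinomial q (n + n) (Suc (n + j))))" if j: "j < n" for j
  proof -
    obtain i where i: "n = j + Suc i"
      using less_imp_Suc_add [OF j] by (metis add_Suc_right)
    have "n * n = n * (j + Suc i)"
      using i by simp
    then have "(Suc (n + j) choose 2) + n * i = ((n choose 2) + n * n) + ((j choose 2) + j)"
      unfolding Suc_choose_2 choose_2_add by (simp add: algebra_simps)
    then have q: "q ^ (Suc (n + j) choose 2) * (q ^ n) ^ i = q ^ ((n choose 2) + n * n) * (q ^ (j choose 2) * q ^ j)"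
      by (simp flip: power_add power_mult)
    have "n + n - Suc (n + j) = i"
      using i by simp
    then have "?t (Suc (n + j)) = (q ^ (Suc (n + j) choose 2) * (q ^ n) ^ i) * (-1) ^ Suc (n + j)
        * x ^ (b * Suc (n + j)) * qbinomial q (n + n) (Suc (n + j))"
      by (simp only: power_minus [of "x ^ b"] power_mult mult_ac)
    also have "\<dots> = - (q ^ ((n choose 2) + n * n) * q ^ (j choose 2) * ((-1) ^ n * (-1) ^ j)
        * (q ^ j * x ^ (b * Suc (n + j))) * qbinomial q (n + n) (Suc (n + j)))"
      unfolding q by (simp add: power_add)
    also have "q ^ j * x ^ (b * Suc (n + j)) = x ^ (b * n) * x ^ ((m + b) * j + b)"
      by (simp add: q_def algebra_simps flip: power_add power_mult)
    also have "- (q ^ ((n choose 2) + n * n) * q ^ (j choose 2) * ((-1) ^ n * (-1) ^ j)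
        * (x ^ (b * n) * x ^ ((m + b) * j + b)) * qbinomial q (n + n) (Suc (n + j)))
      = - (C * ((-1) ^ j * x ^ (m * (j choose 2) + (m + b) * j + b) * qbinomial q (n + n) (Suc (n + j))))"
      unfolding C_def power_add power_mult q_def by (simp only: mult_ac)
    finally show ?thesis .
  qed
  \<comment> \<open>Recentred at the middle index n, the binomial sum becomes a truncated bilateral
    series, whose two halves are the sums of the statement.\<close>
  have "(\<Sum>k\<le>n + n. ?t k) = (\<Sum>j\<le>n. ?t (n - j)) + (\<Sum>j<n. ?t (Suc (n + j)))"
    by (rule sum_atMost_double)
  also have "\<dots> = C * ?S"
    unfolding right_diff_distrib sum_distrib_left q_def [symmetric]
    unfolding diff_conv_add_uminus sum_negf [symmetric]
    by (intro arg_cong2 [of _ _ _ _ "(+)"] sum.cong refl t1 t2) auto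
  finally have "C * ?P = C * ?S"
    using lhs by (simp only: qbinomial_theorem)
  then show ?thesis
    using \<open>C \<noteq> 0\<close> by simp
qed

text \<open>The terms of index j and -j-1 of the bilateral theta series are paired. The finite
  identity is used with n so large that the q-binomials near the centre, times
  \<open>qpoch q q M\<close>, are 1 modulo X^M.\<close>

lemma jacobi_triple_product_cong:
  assumes "0 < b" "b < m"
  shows "fps_cong M
    (qpoch (fps_X ^ b) (fps_X ^ m) M * qpoch (fps_X ^ (m - b)) (fps_X ^ m) M * qpoch (fps_X ^ m) (fps_X ^ m) M)
    (\<Sum>j\<le>M. (-1) ^ j * (fps_X ^ (m * (j choose 2) + (m - b) * j)
        - fps_X ^ (m * (j choose 2) + (m + b) * j + b)) :: 'a::field fps)"
proof -
  define q where "q = (fps_X ^ m :: 'a fps)"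
  \<comment> \<open>This value keeps the indices n - j and n + j + 1, for j <= M, at distance at
    least M from both 0 and 2n.\<close>
  define n where "n = Suc (M + M)"
  define \<alpha> where "\<alpha> j = m * (j choose 2) + (m - b) * j" for j
  define \<beta> where "\<beta> j = m * (j choose 2) + (m + b) * j + b" for j
  \<comment> \<open>Both exponents are at least j, so the terms beyond j = M vanish modulo
    X^M.\<close>
  have "1 * j \<le> (m - b) * j" "1 * j \<le> (m + b) * j" for j
    by (rule mult_le_mono1; use assms in simp)+
  then have \<alpha>: "j \<le> \<alpha> j" and \<beta>: "j \<le> \<beta> j" for j
    by (simp_all add: \<alpha>_def \<beta>_def trans_le_add1 trans_le_add2)
  have qp: "fps_cong M (qpoch q q i) (qpoch q q M)" if "M \<le> i" for i
    unfolding q_def using assms that by (intro qpoch_X_power_cong) auto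
  \<comment> \<open>In the quotient formula all three Pochhammer products agree with
    \<open>qpoch q q M\<close> modulo X^M, and one copy cancels.\<close>
  have qb: "fps_cong M (qbinomial q (n + n) i * qpoch q q M) 1" if "M \<le> i" "i + M \<le> n + n" for i
  proof (rule fps_cong_mult_cancel [of "qpoch q q M"])
    show "qpoch q q M $ 0 \<noteq> 0"
      using assms by (simp add: q_def qpoch_X_power_nth_0)
    have "fps_cong M (qpoch q q M * (qbinomial q (n + n) i * qpoch q q M))
        (qbinomial q (n + n) i * qpoch q q i * qpoch q q (n + n - i))"
      using that unfolding mult.commute [of "qpoch q q M"]
      by (intro fps_cong_mult fps_cong_sym [OF qp]) auto
    also have "\<dots> = qpoch q q (n + n)"
      using that by (intro qbinomial_qpoch) simp
    also have "fps_cong M \<dots> (qpoch q q M * 1)"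
      using qp [of "n + n"] by (simp add: n_def)
    finally show "fps_cong M (qpoch q q M * (qbinomial q (n + n) i * qpoch q q M)) (qpoch q q M * 1)" .
  qed
  have trunc: "fps_cong M (\<Sum>j\<in>A. (-1) ^ j * fps_X ^ \<gamma> j * qbinomial q (n + n) (g j) * qpoch q q M)
      (\<Sum>j\<le>M. (-1) ^ j * fps_X ^ \<gamma> j)"
    if "finite A" "{..M} \<subseteq> A" "\<And>j. j \<le> \<gamma> j" "\<And>j. j \<le> M \<Longrightarrow> M \<le> g j \<and> g j + M \<le> n + n"
    for A \<gamma> g
  proof -
    have "fps_cong M (\<Sum>j\<in>A. (-1) ^ j * fps_X ^ \<gamma> j * qbinomial q (n + n) (g j) * qpoch q q M)
        (\<Sum>j\<in>A. if j \<le> M then (-1) ^ j * fps_X ^ \<gamma> j else 0)"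
    proof (rule fps_cong_sum)
      fix j
      show "fps_cong M ((-1) ^ j * fps_X ^ \<gamma> j * qbinomial q (n + n) (g j) * qpoch q q M)
          (if j \<le> M then (-1) ^ j * fps_X ^ \<gamma> j else 0)"
      proof (cases "j \<le> M")
        case True
        then have "fps_cong M ((-1) ^ j * fps_X ^ \<gamma> j * (qbinomial q (n + n) (g j) * qpoch q q M))
            ((-1) ^ j * fps_X ^ \<gamma> j * 1)"
          using that(4) by (intro fps_cong_mult qb) auto
        with True show ?thesis by (simp add: mult.assoc)
      next
        case False
        then have "M \<le> \<gamma> j"
          using that(3) [of j] by linarith
        then have "fps_X ^ M dvd (fps_X ^ \<gamma> j :: 'a fps)"
          by (rule le_imp_power_dvd)
        with False show ?thesis
          by (auto intro!: fps_cong_0I intro: dvd_mult2 dvd_mult)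
      qed
    qed
    also have "\<dots> = (\<Sum>j\<in>A \<inter> {..M}. (-1) ^ j * fps_X ^ \<gamma> j)"
      using that(1) by (simp add: sum.If_cases Collect_conj_eq atMost_def)
    also have "A \<inter> {..M} = {..M}"
      using that(2) by auto
    finally show ?thesis .
  qed
  have "fps_cong M
    (qpoch (fps_X ^ b) q M * qpoch (fps_X ^ (m - b)) q M * qpoch q q M)
    (qpoch (fps_X ^ b) q n * qpoch (fps_X ^ (m - b)) q n * qpoch q q M)"
    unfolding q_def n_def using assms
    by (intro fps_cong_mult fps_cong_sym [OF qpoch_X_power_cong] fps_cong_refl) auto
  also have "qpoch (fps_X ^ b) q n * qpoch (fps_X ^ (m - b)) q n =
    (\<Sum>j\<le>n. (-1) ^ j * fps_X ^ \<alpha> j * qbinomial q (n + n) (n - j))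
    - (\<Sum>j<n. (-1) ^ j * fps_X ^ \<beta> j * qbinomial q (n + n) (Suc (n + j)))"
    unfolding q_def \<alpha>_def \<beta>_def using assms by (intro finite_jacobi_triple_product) auto
  also have "\<dots> * qpoch q q M =
    (\<Sum>j\<le>n. (-1) ^ j * fps_X ^ \<alpha> j * qbinomial q (n + n) (n - j) * qpoch q q M)
    - (\<Sum>j<n. (-1) ^ j * fps_X ^ \<beta> j * qbinomial q (n + n) (Suc (n + j)) * qpoch q q M)"
    by (simp add: left_diff_distrib sum_distrib_right)
  also have "fps_cong M \<dots> ((\<Sum>j\<le>M. (-1) ^ j * fps_X ^ \<alpha> j) - (\<Sum>j\<le>M. (-1) ^ j * fps_X ^ \<beta> j))"
    using \<alpha> \<beta> by (intro fps_cong_diff trunc) (auto simp: n_def)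
  finally show ?thesis
    by (simp add: q_def \<alpha>_def \<beta>_def right_diff_distrib sum_subtractf)
qed

lemma qpoch_Suc_shift: "qpoch x y (Suc n) = (1 - x) * qpoch (x * y) y n"
  unfolding qpoch_def by (subst prod.lessThan_Suc_shift) (simp add: mult.assoc)

section \<open>The series solution of the recurrences\<close>

text \<open>For positive \<open>d\<close> this is the q-binomial coefficient of N + n over n in base
  q^d.\<close>

definition gordon_ratio :: "nat \<Rightarrow> nat \<Rightarrow> nat \<Rightarrow> 'a::field fps" where
  "gordon_ratio d N n =
    qpoch (fps_X ^ (d * Suc N)) (fps_X ^ d) n * inverse (qpoch (fps_X ^ d) (fps_X ^ d) n)"

lemma gordon_ratio_0 [simp]: "gordon_ratio d N 0 = 1"
  by (simp add: gordon_ratio_def)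

lemma gordon_ratio_N_0: "0 < d \<Longrightarrow> gordon_ratio d 0 n = 1"
  unfolding gordon_ratio_def using inverse_mult_eq_1' [of "qpoch (fps_X ^ d) (fps_X ^ d) n :: 'a fps"]
  by (simp add: qpoch_X_power_nth_0)

text \<open>The numerator with n + 1 factors can be split at its last factor or at its first; the
  latter leaves the numerator for \<open>Suc N\<close>.\<close>

lemma gordon_ratio_shift:
  "gordon_ratio d N n * (1 - fps_X ^ (d * (n + Suc N))) = (1 - fps_X ^ (d * Suc N)) * gordon_ratio d (Suc N) n"
proof -
  have "qpoch (fps_X ^ (d * Suc N)) (fps_X ^ d) n * (1 - fps_X ^ (d * (n + Suc N)))
      = (qpoch (fps_X ^ (d * Suc N)) (fps_X ^ d) (Suc n) :: 'a fps)"
    unfolding qpoch_Suc by (simp add: algebra_simps power_add power_mult)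
  also have "\<dots> = (1 - fps_X ^ (d * Suc N)) * qpoch (fps_X ^ (d * Suc (Suc N))) (fps_X ^ d) n"
    unfolding qpoch_Suc_shift by (simp add: algebra_simps power_add)
  finally show ?thesis
    by (simp add: gordon_ratio_def mult_ac)
qed

text \<open>The last factor of the denominator cancels, and the first factor of the numerator is
  split off.\<close>

lemma gordon_ratio_Suc:
  assumes "0 < d"
  shows "gordon_ratio d N (Suc n) * (1 - fps_X ^ (d * Suc n)) = (1 - fps_X ^ (d * Suc N)) * gordon_ratio d (Suc N) n"
proof -
  define g where "g = (1 - fps_X ^ (d * Suc n) :: 'a fps)"
  define p where "p n = (qpoch (fps_X ^ d) (fps_X ^ d) n :: 'a fps)" for n
  have "g $ 0 \<noteq> 0"
    using assms by (simp add: g_def)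
  have p: "p (Suc n) = p n * g"
    unfolding p_def g_def qpoch_Suc by (simp add: power_add power_mult)
  have "inverse (p (Suc n)) * g = inverse (p n) * (inverse g * g)"
    unfolding p fps_inverse_mult by (simp only: mult.assoc)
  also have "inverse g * g = 1"
    using \<open>g $ 0 \<noteq> 0\<close> by (rule inverse_mult_eq_1)
  finally have "inverse (p (Suc n)) * g = inverse (p n)" by simp
  moreover have "qpoch (fps_X ^ (d * Suc N)) (fps_X ^ d) (Suc n)
      = (1 - fps_X ^ (d * Suc N)) * (qpoch (fps_X ^ (d * Suc (Suc N))) (fps_X ^ d) n :: 'a fps)"
    unfolding qpoch_Suc_shift by (simp add: algebra_simps power_add)
  ultimately show ?thesis
    unfolding gordon_ratio_def p_def [symmetric] g_def [symmetric] by (simp only: mult.assoc)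
qed

definition gordon_exponent :: "nat \<Rightarrow> nat \<Rightarrow> nat \<Rightarrow> nat \<Rightarrow> nat" where
  "gordon_exponent K d N n = K * n * N + K * n * n + d * (n choose 2)"

lemma gordon_exponent_0 [simp]: "gordon_exponent K d N 0 = 0"
  by (simp add: gordon_exponent_def binomial_eq_0)

lemma gordon_exponent_Suc:
  "gordon_exponent K d N (Suc n) = gordon_exponent K d N n + K * N + 2 * K * n + K + d * n"
  by (simp add: gordon_exponent_def Suc_choose_2 algebra_simps)

lemma gordon_exponent_Suc_N: "gordon_exponent K d (Suc N) n = gordon_exponent K d N n + K * n"
  by (simp add: gordon_exponent_def algebra_simps)

text \<open>The Andrews series at \<open>x = q\<^sup>N\<close>, truncated after the term of index \<open>M\<close>. Since \<open>0 < K\<close>,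
  the later terms vanish modulo \<open>q\<^sup>M\<close>. The subtraction is proper only for \<open>b \<le> K + d\<close>.\<close>

definition gordon_sum :: "nat \<Rightarrow> nat \<Rightarrow> nat \<Rightarrow> nat \<Rightarrow> nat \<Rightarrow> 'a::field fps" where
  "gordon_sum K d M b N = (\<Sum>n\<le>M. (-1) ^ n * gordon_ratio d N n *
    (fps_X ^ (gordon_exponent K d N n + (K + d - b) * n)
     - fps_X ^ (gordon_exponent K d N n + (K + d + b) * n + b * Suc N)))"

lemma gordon_sum_0 [simp]: "gordon_sum K d M 0 N = 0"
  by (simp add: gordon_sum_def)

text \<open>Modulo X^M only the leading 1 of the term n = 0 survives, because all other exponents
  are at least N.\<close>

lemma gordon_sum_cong_1:
  assumes "0 < K" "0 < b" "M \<le> N"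
  shows "fps_cong M (gordon_sum K d M b N) (1 :: 'a::field fps)"
proof -
  let ?t = "\<lambda>n. (-1) ^ n * gordon_ratio d N n *
    (fps_X ^ (gordon_exponent K d N n + (K + d - b) * n)
     - fps_X ^ (gordon_exponent K d N n + (K + d + b) * n + b * Suc N)) :: 'a fps"
  have "fps_cong M (?t n) (if n = 0 then 1 else 0)" for n
  proof (cases "n = 0")
    case True
    have "1 * Suc N \<le> b * Suc N"
      using assms(2) by (intro mult_le_mono1) simp
    then have "fps_cong M (1 - fps_X ^ (b * Suc N) :: 'a fps) (1 - 0)"
      using assms(3) by (intro fps_cong_diff fps_cong_X_power_0) auto
    with True show ?thesis by simp
  next
    case False
    have "1 * N \<le> (K * n) * N"
      using False assms(1) by (intro mult_le_mono1) simp
    then have "M \<le> gordon_exponent K d N n"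
      using assms(3) unfolding gordon_exponent_def by linarith
    then have "fps_cong M (?t n) ((-1) ^ n * gordon_ratio d N n * (0 - 0))"
      by (intro fps_cong_mult fps_cong_diff fps_cong_X_power_0 fps_cong_refl) auto
    with False show ?thesis by simp
  qed
  then have "fps_cong M (\<Sum>n\<le>M. ?t n) (\<Sum>n\<le>M. if n = 0 then 1 else 0)"
    by (rule fps_cong_sum)
  then show ?thesis
    by (simp add: gordon_sum_def)
qed

text \<open>The first part of the summand at \<open>n + 1\<close> and the second part at \<open>n\<close> have the same coefficient.\<close>

lemma gordon_sum_telescope:
  assumes "0 < K" "0 < d"
  shows "fps_cong M
    (\<Sum>n\<le>M. (-1) ^ n * gordon_ratio d N n *
      (fps_X ^ (gordon_exponent K d N n + c * n + s) * (1 - fps_X ^ (d * n))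
       + fps_X ^ w n * (1 - fps_X ^ (d * (n + Suc N)))))
    ((1 - fps_X ^ (d * Suc N)) * (\<Sum>n\<le>M. (-1) ^ n * gordon_ratio d (Suc N) n *
      (fps_X ^ w n - fps_X ^ (gordon_exponent K d N (Suc n) + c * Suc n + s))) :: 'a::field fps)"
proof -
  define g where "g = (1 - fps_X ^ (d * Suc N) :: 'a fps)"
  define x where "x n = (fps_X ^ (gordon_exponent K d N n + c * n + s) :: 'a fps)" for n
  \<comment> \<open>\<open>u\<close> is the part whose index is shifted by one; it vanishes at n = 0
    because of the factor 1 - X^(d n).\<close>
  define u where "u n = (-1) ^ n * gordon_ratio d N n * (x n * (1 - fps_X ^ (d * n)))" for n
  have u_0: "u 0 = 0"
    by (simp add: u_def)
  have u_Suc: "u (Suc n) = - (g * ((-1) ^ n * gordon_ratio d (Suc N) n * x (Suc n)))" for n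
  proof -
    have "u (Suc n) = - ((-1) ^ n * x (Suc n) * (gordon_ratio d N (Suc n) * (1 - fps_X ^ (d * Suc n))))"
      unfolding u_def by (simp add: mult_ac del: mult_Suc_right)
    also have "\<dots> = - ((-1) ^ n * x (Suc n) * (g * gordon_ratio d (Suc N) n))"
      unfolding gordon_ratio_Suc [OF assms(2)] g_def ..
    finally show ?thesis by (simp add: mult_ac)
  qed
  \<comment> \<open>The shift leaves a boundary term at M + 1; its exponent is at least K (M+1)^2 >=
    M.\<close>
  have "1 * Suc M \<le> (K * Suc M) * Suc M"
    using assms(1) by (intro mult_le_mono1) simp
  then have "M \<le> K * Suc M * Suc M"
    by (simp only: mult_1 Suc_leD)
  then have "M \<le> gordon_exponent K d N (Suc M) + c * Suc M + s"
    unfolding gordon_exponent_def by (intro trans_le_add1 [where i = M and m = s]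
      trans_le_add1 [where m = "c * Suc M"] trans_le_add1 [where m = "d * _"] trans_le_add2)
  then have "fps_cong M (u (Suc M)) (- (g * ((-1) ^ M * gordon_ratio d (Suc N) M * 0)))"
    unfolding u_Suc x_def diff_0 [symmetric]
    by (intro fps_cong_mult fps_cong_diff fps_cong_X_power_0 fps_cong_refl)
  then have u_cong: "fps_cong M (u (Suc M)) 0" by simp
  have "(\<Sum>n\<le>M. (-1) ^ n * gordon_ratio d N n * (x n * (1 - fps_X ^ (d * n))
       + fps_X ^ w n * (1 - fps_X ^ (d * (n + Suc N)))))
    = (\<Sum>n\<le>M. u n + (-1) ^ n * fps_X ^ w n * (gordon_ratio d N n * (1 - fps_X ^ (d * (n + Suc N)))))"
    unfolding u_def by (intro sum.cong refl) (simp only: distrib_left mult_ac)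
  also have "\<dots> = (\<Sum>n\<le>M. u n) + (\<Sum>n\<le>M. (-1) ^ n * fps_X ^ w n * (g * gordon_ratio d (Suc N) n))"
    unfolding gordon_ratio_shift sum.distrib g_def ..
  also have "(\<Sum>n\<le>M. u n) = (\<Sum>n\<le>Suc M. u n) - u (Suc M)"
    by simp
  also have "(\<Sum>n\<le>Suc M. u n) = (\<Sum>n\<le>M. u (Suc n))"
    by (subst sum.atMost_Suc_shift) (simp add: u_0)
  also have "fps_cong M ((\<Sum>n\<le>M. u (Suc n)) - u (Suc M)
        + (\<Sum>n\<le>M. (-1) ^ n * fps_X ^ w n * (g * gordon_ratio d (Suc N) n)))
      ((\<Sum>n\<le>M. u (Suc n)) - 0
        + (\<Sum>n\<le>M. (-1) ^ n * fps_X ^ w n * (g * gordon_ratio d (Suc N) n)))"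
    by (intro fps_cong_add fps_cong_diff fps_cong_refl u_cong)
  also have "(\<Sum>n\<le>M. u (Suc n)) - 0
        + (\<Sum>n\<le>M. (-1) ^ n * fps_X ^ w n * (g * gordon_ratio d (Suc N) n))
      = g * (\<Sum>n\<le>M. (-1) ^ n * gordon_ratio d (Suc N) n * (fps_X ^ w n - x (Suc n)))"
    by (simp add: u_Suc sum_distrib_left algebra_simps sum_negf sum_subtractf)
  finally show ?thesis
    by (simp only: x_def g_def)
qed

text \<open>Between b = B and b = B + d the first monomials differ by the factor X^(d n) and the
  second ones by X^(d (n+N+1)), which is the shape that \<open>gordon_sum_telescope\<close>
  handles.\<close>

lemma gordon_sum_step:
  assumes "0 < d" "K = B + C" "0 < K"
  shows "fps_cong M (gordon_sum K d M (B + d) N - gordon_sum K d M B N)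
    (fps_X ^ (B * Suc N) * (1 - fps_X ^ (d * Suc N)) * gordon_sum K d M C (Suc N) :: 'a::field fps)"
proof -
  define F where "F = gordon_exponent K d N"
  define w where "w n = F n + (K + d + B) * n + B * Suc N" for n
  have "gordon_sum K d M (B + d) N - gordon_sum K d M B N
    = (\<Sum>n\<le>M. (-1) ^ n * gordon_ratio d N n *
      (fps_X ^ (F n + C * n + 0) * (1 - fps_X ^ (d * n))
       + fps_X ^ w n * (1 - fps_X ^ (d * (n + Suc N)))) :: 'a fps)"
    unfolding gordon_sum_def sum_subtractf [symmetric] right_diff_distrib [symmetric]
  proof (intro sum.cong refl arg_cong2 [of _ _ _ _ "(*)"])
    fix n
    have 1: "K + d - (B + d) = C" and 2: "K + d - B = C + d"
      using assms(2) by simp_all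
    have "F n + (K + d + (B + d)) * n + (B + d) * Suc N = w n + d * (n + Suc N)"
      by (simp add: w_def algebra_simps)
    then have 3: "fps_X ^ (F n + (K + d + (B + d)) * n + (B + d) * Suc N) = (fps_X ^ w n * fps_X ^ (d * (n + Suc N)) :: 'a fps)"
      by (simp only: power_add)
    have "F n + (C + d) * n = F n + C * n + d * n"
      by (simp add: algebra_simps)
    then have 4: "fps_X ^ (F n + (C + d) * n) = (fps_X ^ (F n + C * n) * fps_X ^ (d * n) :: 'a fps)"
      by (simp only: power_add)
    have "x - y * u - (x * v - y) = x * (1 - v) + y * (1 - u)" for x y u v :: "'a fps"
      by (simp add: algebra_simps)
    then show "(fps_X ^ (gordon_exponent K d N n + (K + d - (B + d)) * n)
         - fps_X ^ (gordon_exponent K d N n + (K + d + (B + d)) * n + (B + d) * Suc N))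
        - (fps_X ^ (gordon_exponent K d N n + (K + d - B) * n)
         - fps_X ^ (gordon_exponent K d N n + (K + d + B) * n + B * Suc N))
      = (fps_X ^ (F n + C * n + 0) * (1 - fps_X ^ (d * n))
       + fps_X ^ w n * (1 - fps_X ^ (d * (n + Suc N))) :: 'a fps)"
      unfolding F_def [symmetric] w_def [symmetric] 1 2 3 4 add_0_right .
  qed
  also have "fps_cong M \<dots> ((1 - fps_X ^ (d * Suc N)) * (\<Sum>n\<le>M. (-1) ^ n * gordon_ratio d (Suc N) n *
      (fps_X ^ w n - fps_X ^ (F (Suc n) + C * Suc n + 0))))"
    unfolding F_def using assms by (intro gordon_sum_telescope)
  \<comment> \<open>After the index shift both monomials contain X^(B (N+1)); what remains is the
    summand at N + 1 with value C.\<close>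
  also have "(\<Sum>n\<le>M. (-1) ^ n * gordon_ratio d (Suc N) n *
      (fps_X ^ w n - fps_X ^ (F (Suc n) + C * Suc n + 0)))
    = fps_X ^ (B * Suc N) * (gordon_sum K d M C (Suc N) :: 'a fps)"
    unfolding gordon_sum_def sum_distrib_left
  proof (intro sum.cong refl)
    fix n
    define E where "E = gordon_exponent K d (Suc N) n"
    have K: "K + d - C = B + d"
      using assms(2) by simp
    have "w n = B * Suc N + (E + (K + d - C) * n)"
      unfolding K E_def gordon_exponent_Suc_N w_def F_def by (simp add: algebra_simps)
    moreover have "F (Suc n) + C * Suc n + 0 = B * Suc N + (E + (K + d + C) * n + C * Suc (Suc N))"
      unfolding E_def gordon_exponent_Suc_N F_def gordon_exponent_Suc unfolding assms(2)
      by (simp add: algebra_simps)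
    ultimately have "fps_X ^ w n - fps_X ^ (F (Suc n) + C * Suc n + 0)
      = (fps_X ^ (B * Suc N) * (fps_X ^ (E + (K + d - C) * n)
         - fps_X ^ (E + (K + d + C) * n + C * Suc (Suc N))) :: 'a fps)"
      by (simp only: power_add right_diff_distrib)
    then show "(-1) ^ n * gordon_ratio d (Suc N) n * (fps_X ^ w n - fps_X ^ (F (Suc n) + C * Suc n + 0))
      = fps_X ^ (B * Suc N) * ((-1) ^ n * gordon_ratio d (Suc N) n *
        (fps_X ^ (gordon_exponent K d (Suc N) n + (K + d - C) * n)
         - fps_X ^ (gordon_exponent K d (Suc N) n + (K + d + C) * n + C * Suc (Suc N))) :: 'a fps)"
      unfolding E_def by (simp only: mult_ac)
  qed
  finally show ?thesis
    by (simp only: mult_ac)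
qed

text \<open>Formally the previous step at \<open>B = -e\<close>: the series is antisymmetric under \<open>b \<mapsto> -b\<close> up to
  a monomial factor, so its values at \<open>e\<close> and \<open>-e\<close> combine.\<close>

lemma gordon_sum_half_step:
  assumes "0 < e" "0 < K"
  shows "fps_cong M (gordon_sum K (2 * e) M e N)
    ((1 - fps_X ^ (e * Suc N)) * gordon_sum K (2 * e) M (K + e) (Suc N) :: 'a::field fps)"
proof (rule fps_cong_mult_cancel)
  define d where "d = 2 * e"
  \<comment> \<open>Multiplying by \<open>h\<close> creates the four monomials that telescope. As d
    = 2e, also 1 - X^(d (N+1)) contains the factor \<open>h\<close>, which finally cancels.\<close>
  define h where "h = (1 + fps_X ^ (e * Suc N) :: 'a fps)"
  show "h $ 0 \<noteq> 0"
    using assms(1) by (simp add: h_def)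
  define F where "F = gordon_exponent K d N"
  define w where "w n = F n + (K + e) * n" for n
  have "h * gordon_sum K d M e N
    = (\<Sum>n\<le>M. (-1) ^ n * gordon_ratio d N n *
      (fps_X ^ (F n + (K + e) * n + e * Suc N) * (1 - fps_X ^ (d * n))
       + fps_X ^ w n * (1 - fps_X ^ (d * (n + Suc N)))) :: 'a fps)"
    unfolding gordon_sum_def sum_distrib_left
  proof (intro sum.cong refl)
    fix n
    define y where "y = (fps_X ^ (e * Suc N) :: 'a fps)"
    define z where "z = (fps_X ^ (d * n) :: 'a fps)"
    have 1: "K + d - e = K + e"
      by (simp add: d_def)
    have "F n + (K + d + e) * n + e * Suc N = w n + d * n + e * Suc N"
      by (simp add: w_def algebra_simps)
    then have 2: "fps_X ^ (F n + (K + d + e) * n + e * Suc N) = fps_X ^ w n * z * y"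
      unfolding z_def y_def by (simp only: power_add)
    have "d * (n + Suc N) = d * n + (e * Suc N + e * Suc N)"
      by (simp add: d_def algebra_simps)
    then have 3: "fps_X ^ (d * (n + Suc N)) = z * (y * y)"
      unfolding z_def y_def by (simp only: power_add)
    have 4: "fps_X ^ (w n + e * Suc N) = fps_X ^ w n * y"
      unfolding y_def by (simp only: power_add)
    have "(1 + y) * (fps_X ^ w n - fps_X ^ w n * z * y)
      = fps_X ^ w n * y * (1 - z) + fps_X ^ w n * (1 - z * (y * y))"
      by (simp add: algebra_simps)
    then have "h * (fps_X ^ (F n + (K + d - e) * n) - fps_X ^ (F n + (K + d + e) * n + e * Suc N))
      = fps_X ^ (F n + (K + e) * n + e * Suc N) * (1 - fps_X ^ (d * n))
       + fps_X ^ w n * (1 - fps_X ^ (d * (n + Suc N)))"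
      unfolding 1 2 3 4 h_def w_def [symmetric] y_def [symmetric] z_def [symmetric] .
    then show "h * ((-1) ^ n * gordon_ratio d N n *
        (fps_X ^ (gordon_exponent K d N n + (K + d - e) * n)
         - fps_X ^ (gordon_exponent K d N n + (K + d + e) * n + e * Suc N)))
      = (-1) ^ n * gordon_ratio d N n *
      (fps_X ^ (F n + (K + e) * n + e * Suc N) * (1 - fps_X ^ (d * n))
       + fps_X ^ w n * (1 - fps_X ^ (d * (n + Suc N))))"
      unfolding F_def mult.left_commute [of h] by (simp only:)
  qed
  also have "fps_cong M \<dots> ((1 - fps_X ^ (d * Suc N)) * (\<Sum>n\<le>M. (-1) ^ n * gordon_ratio d (Suc N) n *
      (fps_X ^ w n - fps_X ^ (F (Suc n) + (K + e) * Suc n + e * Suc N))))"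
    unfolding F_def using assms by (intro gordon_sum_telescope) (auto simp: d_def)
  also have "(\<Sum>n\<le>M. (-1) ^ n * gordon_ratio d (Suc N) n *
      (fps_X ^ w n - fps_X ^ (F (Suc n) + (K + e) * Suc n + e * Suc N)))
    = (gordon_sum K d M (K + e) (Suc N) :: 'a fps)"
    unfolding gordon_sum_def
  proof (intro sum.cong refl arg_cong2 [of _ _ _ _ "(*)"] arg_cong2 [of _ _ _ _ "(-)"]
      arg_cong2 [of _ _ _ _ "(^)"])
    fix n
    have K: "K + d - (K + e) = e"
      by (simp add: d_def)
    show "w n = gordon_exponent K d (Suc N) n + (K + d - (K + e)) * n"
      unfolding K gordon_exponent_Suc_N w_def F_def by (simp add: algebra_simps)
    show "F (Suc n) + (K + e) * Suc n + e * Suc N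
      = gordon_exponent K d (Suc N) n + (K + d + (K + e)) * n + (K + e) * Suc (Suc N)"
      unfolding gordon_exponent_Suc_N F_def gordon_exponent_Suc by (simp add: d_def algebra_simps)
  qed
  also have "(1 - fps_X ^ (d * Suc N)) = h * (1 - fps_X ^ (e * Suc N))"
    by (simp add: h_def d_def algebra_simps flip: power_add)
  finally show "fps_cong M (h * gordon_sum K (2 * e) M e N)
    (h * ((1 - fps_X ^ (e * Suc N)) * gordon_sum K (2 * e) M (K + e) (Suc N)))"
    unfolding d_def mult.assoc .
qed

text \<open>At N = 0 all ratios are 1, and n^2 = 2 (n choose 2) + n turns the quadratic exponent
  into m (n choose 2) + K n, that of a theta series.\<close>

lemma gordon_sum_triple_product:
  assumes "0 < d" "0 < b" "b \<le> K + d" "0 < K"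
  defines "m \<equiv> 2 * K + d"
  shows "fps_cong M (gordon_sum K d M b 0)
    (qpoch (fps_X ^ b) (fps_X ^ m) M * qpoch (fps_X ^ (m - b)) (fps_X ^ m) M
      * qpoch (fps_X ^ m) (fps_X ^ m) M :: 'a::field fps)"
proof -
  have F: "gordon_exponent K d 0 n = m * (n choose 2) + K * n" for n
    using arg_cong [OF square_eq_choose_2 [of n], of "(*) K"]
    by (simp add: gordon_exponent_def m_def algebra_simps)
  have "gordon_exponent K d 0 n + (K + d - b) * n = m * (n choose 2) + (m - b) * n" for n
  proof -
    have "m - b = K + (K + d - b)"
      using assms by simp
    then show ?thesis
      by (simp only: F distrib_right add.assoc)
  qed
  moreover have "gordon_exponent K d 0 n + (K + d + b) * n + b * Suc 0 = m * (n choose 2) + (m + b) * n + b" for n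
    unfolding F by (simp add: m_def algebra_simps)
  ultimately have "gordon_sum K d M b 0 = (\<Sum>j\<le>M. (-1) ^ j * (fps_X ^ (m * (j choose 2) + (m - b) * j)
        - fps_X ^ (m * (j choose 2) + (m + b) * j + b)) :: 'a fps)"
    unfolding gordon_sum_def using assms(1) by (simp only: gordon_ratio_N_0 mult_1_right)
  then show ?thesis
    using assms by (auto intro!: fps_cong_sym [OF jacobi_triple_product_cong])
qed

section \<open>The generating functions of the partitions\<close>

definition gordon_partitions :: "nat \<Rightarrow> nat \<Rightarrow> nat \<Rightarrow> nat \<Rightarrow> nat \<Rightarrow> nat list set" where
  "gordon_partitions K d N b n = {xs \<in> partitions_of n. (\<forall>x\<in>set xs. N < x) \<and>
      (\<forall>i\<ge>1. phi xs i + phi xs (i + 1) < K) \<and> phi xs (Suc N) < b \<and>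
      (\<forall>i. odd i \<longrightarrow> d dvd phi xs i)}"

lemma dB_set_eq: "dB_set d k e a n = gordon_partitions (d * k + e) d 0 (d * a) n"
  by (auto simp: dB_set_def gordon_partitions_def partitions_of_def elim!: oddE)

lemma finite_partitions_of: "finite (partitions_of n)"
proof (rule finite_subset)
  show "partitions_of n \<subseteq> {xs. set xs \<subseteq> {..n} \<and> length xs \<le> n}"
  proof
    fix xs assume "xs \<in> partitions_of n"
    then have pos: "\<forall>x\<in>set xs. 0 < x" and n: "sum_list xs = n"
      by (auto simp: partitions_of_def)
    have "length xs \<le> sum_list xs"
      using pos by (induction xs) auto
    with n show "xs \<in> {xs. set xs \<subseteq> {..n} \<and> length xs \<le> n}"
      using member_le_sum_list by fastforce
  qed
qed (rule finite_lists_length_le, simp)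

lemma finite_gordon_partitions [simp]: "finite (gordon_partitions K d N b n)"
  by (rule finite_subset [OF _ finite_partitions_of]) (auto simp: gordon_partitions_def)

lemma count_list_replicate: "count_list (replicate n x) y = (if x = y then n else 0)"
  by (induction n) auto

lemma phi_append_replicate: "phi (xs @ replicate b c) i = phi xs i + (if i = c then b else 0)"
  by (simp add: phi_def count_list_replicate)

lemma phi_eq_0: "\<forall>x\<in>set xs. N < x \<Longrightarrow> i \<le> N \<Longrightarrow> phi xs i = 0"
  unfolding phi_def by (rule count_notin) auto

lemma sorted_wrt_ge_split_min:
  fixes xs :: "nat list"
  assumes "sorted_wrt (\<ge>) xs" "\<forall>x\<in>set xs. c \<le> x"
  shows "xs = filter (\<lambda>x. x \<noteq> c) xs @ replicate (count_list xs c) c"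
  using assms
proof (induction xs)
  case (Cons x xs)
  show ?case
  proof (cases "x = c")
    case True
    with Cons.prems have "y = c" if "y \<in> set xs" for y
      using that by (auto intro: antisym)
    then have "filter (\<lambda>x. x \<noteq> c) xs = []"
      by (auto simp: filter_empty_conv)
    then show ?thesis
      using Cons True by auto
  next
    case False
    then show ?thesis
      using Cons by auto
  qed
qed simp

text \<open>The pair N + 1, N + 2 bounds \<open>phi\<close> at N + 2 by K - b; truncated subtraction
  makes this unsatisfiable for b >= K, as it should be. The pair N, N + 1 then follows.\<close>

lemma append_replicate_mem_gordon_partitions_iff:
  assumes "even N \<longrightarrow> d dvd b" "\<forall>x\<in>set ys. Suc N < x"
  shows "ys @ replicate b (Suc N) \<in> gordon_partitions K d N (Suc b) (n + Suc N * b)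
    \<longleftrightarrow> ys \<in> gordon_partitions K d (Suc N) (K - b) n"
proof -
  let ?xs = "ys @ replicate b (Suc N)"
  have 0: "phi ys i = 0" if "i \<le> Suc N" for i
    using phi_eq_0 [OF assms(2) that] .
  have "sorted_wrt (\<ge>) (replicate b (Suc N))"
    by (induction b) auto
  then have "?xs \<in> partitions_of (n + Suc N * b) \<longleftrightarrow> ys \<in> partitions_of n"
    using assms(2) by (auto simp: partitions_of_def sorted_wrt_append sum_list_replicate less_imp_le)
  moreover have "(\<forall>i\<ge>1. phi ?xs i + phi ?xs (i + 1) < K)
      \<longleftrightarrow> (\<forall>i\<ge>1. phi ys i + phi ys (i + 1) < K) \<and> phi ys (Suc (Suc N)) < K - b" (is "?L \<longleftrightarrow> ?R")
  proof
    assume L: ?L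
    have "phi ys i + phi ys (i + 1) < K" if "i \<ge> 1" for i
      using L that unfolding phi_append_replicate by (metis add_lessD1 add.commute add.left_commute)
    moreover have "phi ys (Suc (Suc N)) < K - b"
      using L [rule_format, of "Suc N"] 0 [of "Suc N"] by (simp add: phi_append_replicate)
    ultimately show ?R by blast
  next
    assume R: ?R
    show ?L
    proof (intro allI impI)
      fix i :: nat assume "i \<ge> 1"
      with R have "phi ys i + phi ys (i + 1) < K" by blast
      then show "phi ?xs i + phi ?xs (i + 1) < K"
        using R 0 [of "Suc N"] 0 [of N] by (auto simp: phi_append_replicate)
    qed
  qed
  moreover have "d dvd phi ?xs i \<longleftrightarrow> d dvd phi ys i" if "odd i" for i
    using that assms(1) 0 [of "Suc N"] by (cases "i = Suc N") (auto simp: phi_append_replicate)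
  then have "(\<forall>i. odd i \<longrightarrow> d dvd phi ?xs i) \<longleftrightarrow> (\<forall>i. odd i \<longrightarrow> d dvd phi ys i)"
    by blast
  moreover have "phi ?xs (Suc N) < Suc b"
    using 0 [of "Suc N"] by (simp add: phi_append_replicate)
  moreover have "\<forall>x\<in>set ?xs. N < x"
    using assms(2) by auto
  ultimately show ?thesis
    using assms(2) unfolding gordon_partitions_def by blast
qed

text \<open>Removing all copies of N + 1 is inverse to appending b of them.\<close>

lemma card_gordon_partitions_exact:
  assumes "even N \<longrightarrow> d dvd b"
  shows "card {xs \<in> gordon_partitions K d N (Suc b) (n + Suc N * b). phi xs (Suc N) = b}
    = card (gordon_partitions K d (Suc N) (K - b) n)" (is "card ?A = card ?B")
proof -
  have "bij_betw (\<lambda>ys. ys @ replicate b (Suc N)) ?B ?A"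
  proof (rule bij_betwI')
    fix ys assume ys: "ys \<in> ?B"
    then have *: "\<forall>x\<in>set ys. Suc N < x"
      by (simp add: gordon_partitions_def)
    with ys show "ys @ replicate b (Suc N) \<in> ?A"
      using append_replicate_mem_gordon_partitions_iff [OF assms *]
      by (simp add: phi_append_replicate phi_eq_0)
  next
    fix xs assume xs: "xs \<in> ?A"
    define ys where "ys = filter (\<lambda>x. x \<noteq> Suc N) xs"
    have "xs = ys @ replicate b (Suc N)"
      using xs sorted_wrt_ge_split_min [of xs "Suc N"]
      by (auto simp: gordon_partitions_def partitions_of_def phi_def ys_def Suc_le_eq)
    moreover have *: "\<forall>x\<in>set ys. Suc N < x"
      using xs by (auto simp: gordon_partitions_def ys_def less_Suc_eq intro: Suc_lessI)
    ultimately show "\<exists>ys\<in>?B. xs = ys @ replicate b (Suc N)"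
      using xs append_replicate_mem_gordon_partitions_iff [OF assms *] by auto
  qed simp
  then show ?thesis
    by (simp add: bij_betw_same_card)
qed

section \<open>Generating functions and their recurrences\<close>

definition gordon_gf :: "nat \<Rightarrow> nat \<Rightarrow> nat \<Rightarrow> nat \<Rightarrow> 'a::field fps" where
  "gordon_gf K d N b = Abs_fps (\<lambda>n. of_nat (card (gordon_partitions K d N b n)))"

lemma gordon_gf_0 [simp]: "gordon_gf K d N 0 = 0"
  by (simp add: gordon_gf_def gordon_partitions_def fps_eq_iff)

text \<open>The additional partitions contain N + 1 exactly b times. There are none if N + 1 is odd
  and d does not divide b; otherwise removing these parts lowers the sum by b (N+1).\<close>

lemma gordon_gf_Suc:
  "(gordon_gf K d N (Suc b) :: 'a::field fps) = gordon_gf K d N b +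
    (if even N \<and> \<not> d dvd b then 0 else fps_X ^ (b * Suc N) * gordon_gf K d (Suc N) (K - b))"
proof (rule fps_ext)
  fix n
  let ?A = "{xs \<in> gordon_partitions K d N (Suc b) n. phi xs (Suc N) = b}"
  have "gordon_partitions K d N (Suc b) n = gordon_partitions K d N b n \<union> ?A"
    by (auto simp: gordon_partitions_def less_Suc_eq)
  moreover have "gordon_partitions K d N b n \<inter> ?A = {}"
    by (auto simp: gordon_partitions_def)
  ultimately have Suc: "card (gordon_partitions K d N (Suc b) n) = card (gordon_partitions K d N b n) + card ?A"
    using card_Un_disjoint [of "gordon_partitions K d N b n" ?A] by simp
  have A: "of_nat (card ?A) = ((if even N \<and> \<not> d dvd b then 0
      else fps_X ^ (b * Suc N) * gordon_gf K d (Suc N) (K - b)) $ n :: 'a)"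
  proof (cases "even N \<and> \<not> d dvd b")
    case True
    then have "odd (Suc N)" by simp
    with True have A: "?A = {}"
      unfolding gordon_partitions_def by blast
    show ?thesis
      unfolding A using True by simp
  next
    case False
    show ?thesis
    proof (cases "n < b * Suc N")
      case True
      have "b * Suc N \<le> n" if "xs \<in> ?A" for xs
      proof -
        have "xs = filter (\<lambda>x. x \<noteq> Suc N) xs @ replicate b (Suc N)"
          using that sorted_wrt_ge_split_min [of xs "Suc N"]
          by (auto simp: gordon_partitions_def partitions_of_def phi_def Suc_le_eq)
        then have "sum_list xs = sum_list (filter (\<lambda>x. x \<noteq> Suc N) xs @ replicate b (Suc N))"
          by (rule arg_cong)
        moreover have "sum_list xs = n"
          using that by (simp add: gordon_partitions_def partitions_of_def)
        ultimately show ?thesis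
          by (simp only: sum_list_append sum_list_replicate of_nat_id le_add2)
      qed
      with True have "?A = {}"
        using leD by blast
      with False True show ?thesis
        by (simp only: fps_X_power_mult_nth if_False if_True card.empty of_nat_0)
    next
      case le: False
      then have "card ?A = card (gordon_partitions K d (Suc N) (K - b) (n - b * Suc N))"
        using card_gordon_partitions_exact [of N d b K "n - b * Suc N"] False
        by (simp only: mult.commute [of b] not_less le_add_diff_inverse2 de_Morgan_conj not_not imp_conv_disj)
      with False le show ?thesis
        by (simp only: fps_X_power_mult_nth if_False gordon_gf_def fps_nth_Abs_fps)
    qed
  qed
  have "gordon_gf K d N b' $ n = (of_nat (card (gordon_partitions K d N b' n)) :: 'a)" for b'
    by (simp add: gordon_gf_def)
  then show "(gordon_gf K d N (Suc b) :: 'a fps) $ n = (gordon_gf K d N b +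
    (if even N \<and> \<not> d dvd b then 0 else fps_X ^ (b * Suc N) * gordon_gf K d (Suc N) (K - b))) $ n"
    unfolding fps_add_nth by (simp only: Suc of_nat_add A)
qed

lemma gordon_gf_cong_1:
  assumes "0 < K" "0 < b" "M \<le> N"
  shows "fps_cong M (gordon_gf K d N b) 1"
proof -
  have "gordon_partitions K d N b i = (if i = 0 then {[]} else {})" if "i < M" for i
  proof -
    have "xs = []" if "xs \<in> gordon_partitions K d N b i" for xs
    proof (cases xs)
      case (Cons x ys)
      with that have "x \<le> i" "N < x"
        by (auto simp: gordon_partitions_def partitions_of_def)
      with \<open>i < M\<close> assms(3) show ?thesis by simp
    qed simp
    moreover have "[] \<in> gordon_partitions K d N b i \<longleftrightarrow> i = 0"
      using assms by (auto simp: gordon_partitions_def partitions_of_def phi_def)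
    ultimately show ?thesis by (auto split: if_splits)
  qed
  then show ?thesis
    by (simp add: fps_cong_iff_nth gordon_gf_def)
qed

text \<open>For odd N the part N + 1 is even, so every multiplicity is allowed; a block of j
  multiplicities with the same remaining series \<open>H\<close> gives a geometric sum.\<close>

lemma gordon_gf_add:
  assumes "odd N" "\<And>i. i < j \<Longrightarrow> gordon_gf K d (Suc N) (K - (b + i)) = H"
  shows "gordon_gf K d N (b + j) = gordon_gf K d N b + fps_X ^ (b * Suc N) * (\<Sum>i<j. (fps_X ^ Suc N) ^ i) * H"
  using assms(2)
proof (induction j)
  case (Suc j)
  have "gordon_gf K d N (b + Suc j)
      = gordon_gf K d N (b + j) + fps_X ^ ((b + j) * Suc N) * gordon_gf K d (Suc N) (K - (b + j))"
    using assms(1) by (simp add: gordon_gf_Suc)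
  also have "\<dots> = gordon_gf K d N b + fps_X ^ (b * Suc N) * (\<Sum>i<j. (fps_X ^ Suc N) ^ i) * H
      + fps_X ^ ((b + j) * Suc N) * H"
    using Suc.prems Suc.IH by simp
  also have "fps_X ^ ((b + j) * Suc N) = (fps_X ^ (b * Suc N) * (fps_X ^ Suc N) ^ j :: 'a fps)"
    unfolding power_mult [symmetric] power_add [symmetric] by (simp only: distrib_right mult.commute [of "Suc N"])
  finally show ?case
    by (simp only: sum.lessThan_Suc distrib_left distrib_right add.assoc)
qed simp

text \<open>The part N + 1 is odd, so among the multiplicities from d a to d a + d - 1 only d a
  itself contributes.\<close>

lemma gordon_gf_even:
  assumes "even N" "0 < j" "j \<le> d"
  shows "gordon_gf K d N (d * a + j) = gordon_gf K d N (d * a)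
    + fps_X ^ (d * a * Suc N) * gordon_gf K d (Suc N) (K - d * a)"
  using assms(2,3)
proof (induction j rule: nat_induct_non_zero)
  case 1
  then show ?case by (simp add: gordon_gf_Suc)
next
  case (Suc j)
  then have "\<not> d dvd d * a + j"
    by (auto dest: dvd_imp_le simp: dvd_add_right_iff)
  with Suc assms(1) show ?case by (simp add: gordon_gf_Suc)
qed

corollary gordon_gf_even_const:
  assumes "even N" "0 < j" "j \<le> d"
  shows "gordon_gf K d N (d * a + j) = gordon_gf K d N (d * Suc a)"
proof -
  have d: "d * Suc a = d * a + d" by simp
  show ?thesis
    unfolding d gordon_gf_even [OF assms] using assms
    by (intro gordon_gf_even [of N d d K a, symmetric]) auto
qed

text \<open>These are factors of the denominator in the theorem: odd i come from the product in q^d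
  with base q^(2d), even i from the product in q^2.\<close>

definition gordon_denominator :: "nat \<Rightarrow> nat \<Rightarrow> nat \<Rightarrow> 'a::field fps" where
  "gordon_denominator d M N = (\<Prod>i\<in>{N<..M}. 1 - fps_X ^ (if odd i then d * i else i))"

lemma gordon_denominator_rec:
  assumes "N < M"
  shows "gordon_denominator d M N
    = (1 - fps_X ^ (if even N then d * Suc N else Suc N)) * gordon_denominator d M (Suc N)"
proof -
  have "{N<..M} = insert (Suc N) {Suc N<..M}"
    using assms by auto
  then show ?thesis
    by (simp add: gordon_denominator_def)
qed

lemma gordon_denominator_cong:
  assumes "0 < d"
  shows "fps_cong M (gordon_denominator d M 0)
    (qpoch (fps_X ^ d) (fps_X ^ (2 * d)) M * qpoch (fps_X ^ 2) (fps_X ^ 2) M :: 'a::field fps)"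
proof -
  define w where "w i = (1 - fps_X ^ (if odd i then d * i else i) :: 'a fps)" for i
  \<comment> \<open>Continuing the product to 2M changes nothing modulo X^M and gives equally many
    odd and even indices.\<close>
  have "fps_cong M (\<Prod>i\<in>{0<..M}. w i) (\<Prod>i\<in>{0<..2 * M}. w i)"
  proof -
    have "fps_cong M (w i) 1" if "i \<in> {M<..2 * M}" for i
    proof -
      have "M \<le> 1 * i"
        using that by simp
      also have "1 * i \<le> d * i"
        using assms by (intro mult_le_mono1) simp
      finally have "fps_cong M (w i) (1 - 0)"
        unfolding w_def using that by (intro fps_cong_diff fps_cong_X_power_0) auto
      then show ?thesis by simp
    qed
    then have "fps_cong M (\<Prod>i\<in>{M<..2 * M}. w i) (\<Prod>i\<in>{M<..2 * M}. 1)"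
      by (rule fps_cong_prod)
    then have "fps_cong M ((\<Prod>i\<in>{0<..M}. w i) * (\<Prod>i\<in>{M<..2 * M}. w i)) ((\<Prod>i\<in>{0<..M}. w i) * 1)"
      by (intro fps_cong_mult fps_cong_refl) simp
    moreover have "{0<..2 * M} = {0<..M} \<union> {M<..2 * M}"
      by auto
    ultimately show ?thesis
      by (simp add: prod.union_disjoint fps_cong_sym)
  qed
  moreover have "(\<Prod>i\<in>{0<..2 * n}. w i) = qpoch (fps_X ^ d) (fps_X ^ (2 * d)) n * qpoch (fps_X ^ 2) (fps_X ^ 2) n" for n
  proof (induction n)
    case (Suc n)
    have "{0<..2 * Suc n} = insert (Suc (2 * n)) (insert (2 * Suc n) {0<..2 * n})"
      by auto
    then have "(\<Prod>i\<in>{0<..2 * Suc n}. w i) = w (Suc (2 * n)) * (w (2 * Suc n) * (\<Prod>i\<in>{0<..2 * n}. w i))"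
      by simp
    moreover have "w (Suc (2 * n)) = 1 - fps_X ^ d * (fps_X ^ (2 * d)) ^ n"
      unfolding power_mult [symmetric] power_add [symmetric] by (simp add: w_def algebra_simps)
    moreover have "w (2 * Suc n) = 1 - fps_X ^ 2 * (fps_X ^ 2) ^ n"
      unfolding power_mult [symmetric] power_add [symmetric] by (simp add: w_def)
    ultimately show ?case
      unfolding qpoch_Suc by (simp only: Suc.IH) (simp only: mult_ac)
  qed simp
  ultimately show ?thesis
    by (simp add: gordon_denominator_def w_def)
qed

section \<open>Comparison\<close>

text \<open>The denominator at N supplies exactly the factor 1 - X^(d (N+1)) of
  \<open>gordon_sum_step\<close> with B = d a.\<close>

lemma gordon_gf_even_step:
  assumes "even N" "N < M" "0 < d" "K = d * a + C"
    "fps_cong M (gordon_gf K d N (d * a) * gordon_denominator d M N) (gordon_sum K d M (d * a) N :: 'a::field fps)"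
    "fps_cong M (gordon_gf K d (Suc N) C * gordon_denominator d M (Suc N)) (gordon_sum K d M C (Suc N) :: 'a fps)"
    "0 < K"
  shows "fps_cong M (gordon_gf K d N (d * Suc a) * gordon_denominator d M N)
    (gordon_sum K d M (d * Suc a) N :: 'a fps)"
proof -
  define x where "x = (fps_X ^ (d * a * Suc N) :: 'a fps)"
  define g where "g = (1 - fps_X ^ (d * Suc N) :: 'a fps)"
  have D: "gordon_denominator d M N = g * gordon_denominator d M (Suc N)"
    using gordon_denominator_rec [OF assms(2), of d] assms(1) by (simp only: g_def if_True)
  have d: "d * Suc a = d * a + d" by simp
  have G: "gordon_gf K d N (d * Suc a) = gordon_gf K d N (d * a) + x * gordon_gf K d (Suc N) C"
    using gordon_gf_even [of N d d K a] assms(1,3,4) unfolding d x_def by simp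
  have "gordon_gf K d N (d * Suc a) * gordon_denominator d M N
      = gordon_gf K d N (d * a) * gordon_denominator d M N
        + x * g * (gordon_gf K d (Suc N) C * gordon_denominator d M (Suc N))"
    unfolding G distrib_right D by (simp only: mult_ac)
  also have "fps_cong M \<dots> (gordon_sum K d M (d * a) N + x * g * gordon_sum K d M C (Suc N))"
    using assms(5,6) by (intro fps_cong_add fps_cong_mult [OF fps_cong_refl])
  also have "fps_cong M \<dots> (gordon_sum K d M (d * a) N
      + (gordon_sum K d M (d * a + d) N - gordon_sum K d M (d * a) N))"
    unfolding x_def g_def using assms
    by (intro fps_cong_add fps_cong_refl fps_cong_sym [OF gordon_sum_step])
  finally show ?thesis
    unfolding d by simp
qed

text \<open>Here the denominator supplies only 1 - X^(N+1); the geometric sum over d multiplicities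
  completes it to 1 - X^(d (N+1)).\<close>

lemma gordon_gf_odd_step:
  assumes "odd N" "N < M" "0 < d" "K = B + d * Suc c"
    "fps_cong M (gordon_gf K d N B * gordon_denominator d M N) (gordon_sum K d M B N :: 'a::field fps)"
    "fps_cong M (gordon_gf K d (Suc N) (d * Suc c) * gordon_denominator d M (Suc N))
       (gordon_sum K d M (d * Suc c) (Suc N) :: 'a fps)"
  shows "fps_cong M (gordon_gf K d N (B + d) * gordon_denominator d M N)
    (gordon_sum K d M (B + d) N :: 'a fps)"
proof -
  define x where "x = (fps_X ^ (B * Suc N) :: 'a fps)"
  define s where "s = (\<Sum>i<d. (fps_X ^ Suc N) ^ i :: 'a fps)"
  define g where "g = (1 - fps_X ^ Suc N :: 'a fps)"
  have D: "gordon_denominator d M N = g * gordon_denominator d M (Suc N)"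
    using gordon_denominator_rec [OF assms(2), of d] assms(1) by (simp only: g_def if_False)
  \<comment> \<open>The bounds K - (B + i) run from d c + 1 to d (c + 1), where the generating
    function at the even level N + 1 is constant.\<close>
  have "gordon_gf K d (Suc N) (K - (B + i)) = (gordon_gf K d (Suc N) (d * Suc c) :: 'a fps)" if "i < d" for i
  proof -
    have "K - (B + i) = d * c + (d - i)"
      using assms(4) that by simp
    then show ?thesis
      using gordon_gf_even_const [of "Suc N" "d - i" d K c] assms(1) that by simp
  qed
  then have G: "gordon_gf K d N (B + d) = gordon_gf K d N B + x * s * gordon_gf K d (Suc N) (d * Suc c)"
    unfolding x_def s_def by (rule gordon_gf_add [OF assms(1)])
  have s: "g * s = 1 - fps_X ^ (d * Suc N)"
    unfolding g_def s_def mult.commute [of d] power_mult by (rule one_diff_power_eq [symmetric])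
  have "gordon_gf K d N (B + d) * gordon_denominator d M N
      = gordon_gf K d N B * gordon_denominator d M N
        + x * (g * s) * (gordon_gf K d (Suc N) (d * Suc c) * gordon_denominator d M (Suc N))"
    unfolding G distrib_right D by (simp only: mult_ac)
  also have "fps_cong M \<dots> (gordon_sum K d M B N + x * (g * s) * gordon_sum K d M (d * Suc c) (Suc N))"
    using assms(5,6) by (intro fps_cong_add fps_cong_mult [OF fps_cong_refl])
  also have "fps_cong M \<dots> (gordon_sum K d M B N + (gordon_sum K d M (B + d) N - gordon_sum K d M B N))"
    unfolding x_def s using assms(3,4)
    by (intro fps_cong_add fps_cong_refl fps_cong_sym [OF gordon_sum_step]) auto
  finally show ?thesis by simp
qed

text \<open>This gives the starting value for odd N when d = 2e. The bounds K - i with i < e lie in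
  the same block as K + e = d (k + 1), so the geometric sum has e terms, matching
  \<open>gordon_sum_half_step\<close>.\<close>

lemma gordon_gf_half_step:
  assumes "odd N" "N < M" "0 < e" "K = 2 * e * k + e"
    "fps_cong M (gordon_gf K (2 * e) (Suc N) (K + e) * gordon_denominator (2 * e) M (Suc N))
       (gordon_sum K (2 * e) M (K + e) (Suc N) :: 'a::field fps)"
  shows "fps_cong M (gordon_gf K (2 * e) N e * gordon_denominator (2 * e) M N)
    (gordon_sum K (2 * e) M e N :: 'a fps)"
proof -
  define s where "s = (\<Sum>i<e. (fps_X ^ Suc N) ^ i :: 'a fps)"
  define g where "g = (1 - fps_X ^ Suc N :: 'a fps)"
  have D: "gordon_denominator (2 * e) M N = g * gordon_denominator (2 * e) M (Suc N)"
    using gordon_denominator_rec [OF assms(2), of "2 * e"] assms(1) by (simp only: g_def if_False)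
  have "gordon_gf K (2 * e) (Suc N) (K - (0 + i)) = (gordon_gf K (2 * e) (Suc N) (K + e) :: 'a fps)"
    if "i < e" for i
  proof -
    have 1: "K - (0 + i) = 2 * e * k + (e - i)" and 2: "K + e = 2 * e * Suc k"
      using assms(4) that by simp_all
    show ?thesis
      unfolding 1 2 using assms(1) that by (intro gordon_gf_even_const) auto
  qed
  then have "gordon_gf K (2 * e) N (0 + e)
      = gordon_gf K (2 * e) N 0 + fps_X ^ (0 * Suc N) * s * gordon_gf K (2 * e) (Suc N) (K + e)"
    unfolding s_def by (rule gordon_gf_add [OF assms(1)])
  then have G: "gordon_gf K (2 * e) N e = s * gordon_gf K (2 * e) (Suc N) (K + e)"
    by simp
  have s: "g * s = 1 - fps_X ^ (e * Suc N)"
    unfolding g_def s_def mult.commute [of e] power_mult by (rule one_diff_power_eq [symmetric])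
  have "gordon_gf K (2 * e) N e * gordon_denominator (2 * e) M N
      = (g * s) * (gordon_gf K (2 * e) (Suc N) (K + e) * gordon_denominator (2 * e) M (Suc N))"
    unfolding G D by (simp only: mult_ac)
  also have "fps_cong M \<dots> ((g * s) * gordon_sum K (2 * e) M (K + e) (Suc N))"
    using assms(5) by (intro fps_cong_mult [OF fps_cong_refl])
  also have "fps_cong M \<dots> (gordon_sum K (2 * e) M e N)"
    unfolding s using assms(3,4) by (intro fps_cong_sym [OF gordon_sum_half_step]) auto
  finally show ?thesis .
qed

text \<open>The even levels must reach a = k + 1: the odd levels use the value d (k + 1), either as
  K itself or as K + e in the half step.\<close>

lemma gordon_gf_cong_gordon_sum:
  fixes d k e K M N :: nat
  assumes "0 < d" "e = d \<or> 2 * e = d" "N \<le> M"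
  defines "K \<equiv> d * k + e"
  defines "claim \<equiv> \<lambda>b N. fps_cong M (gordon_gf K d N b * gordon_denominator d M N)
    (gordon_sum K d M b N :: 'a::field fps)"
  shows "if even N then \<forall>a\<le>Suc k. claim (d * a) N else \<forall>b\<le>K. d dvd K - b \<longrightarrow> claim b N"
  using assms(3)
proof (induction rule: inc_induct)
  case base
  have "0 < K"
    using assms(1,2) by (auto simp: K_def)
  \<comment> \<open>At N = M the denominator is an empty product and both sides are 1 modulo X^M;
    for b = 0 both are 0.\<close>
  have "claim b M" for b
  proof (cases "b = 0")
    case False
    then have "fps_cong M (gordon_gf K d M b) (1 :: 'a fps)" "fps_cong M (gordon_sum K d M b M) (1 :: 'a fps)"
      using \<open>0 < K\<close> by (auto intro: gordon_gf_cong_1 gordon_sum_cong_1)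
    then show ?thesis
      by (auto simp: claim_def gordon_denominator_def intro: fps_cong_trans fps_cong_sym)
  qed (simp add: claim_def)
  then show ?case by simp
next
  case (step N)
  have "0 < K"
    using assms(1,2) by (auto simp: K_def)
  show ?case
  proof (cases "even N")
    case True
    have IH: "claim b (Suc N)" if "b \<le> K" "d dvd K - b" for b
      using step.IH True that by simp
    have "claim (d * a) N" if "a \<le> Suc k" for a
      using that
    proof (induction a)
      case 0
      then show ?case by (simp add: claim_def)
    next
      case (Suc a)
      have "d * a \<le> d * k"
        using Suc.prems by (intro mult_le_mono2) simp
      then have le: "d * a \<le> K"
        unfolding K_def by (rule trans_le_add1)
      then have K: "K = d * a + (K - d * a)" by simp
      have "claim (K - d * a) (Suc N)"
        using le by (intro IH) auto
      with Suc True step.hyps assms(1) \<open>0 < K\<close> K show ?case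
        unfolding claim_def by (intro gordon_gf_even_step [where C = "K - d * a"]) auto
    qed
    with True show ?thesis by simp
  next
    case False
    then have IH: "claim (d * a) (Suc N)" if "a \<le> Suc k" for a
      using step.IH that by simp
    \<comment> \<open>\<open>r\<close> is K modulo d: 0 if e = d, where the claim is trivial, and e
      if 2 e = d. From it the values congruent to K are reached in steps of d.\<close>
    obtain r T where rT: "K = r + d * T" "T \<le> Suc k" "claim r N" "r < d"
    proof (cases "e = d")
      case True
      show ?thesis
        by (rule that [of 0 "Suc k"]) (use True assms(1) in \<open>simp_all add: K_def claim_def\<close>)
    next
      case e: False
      then have d: "d = 2 * e"
        using assms(2) by simp
      have "K + e = d * Suc k"
        by (simp add: K_def d)
      then have "claim (K + e) (Suc N)"
        using IH [of "Suc k"] by simp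
      then have "claim e N"
        using assms(1) False step.hyps unfolding claim_def d
        by (intro gordon_gf_half_step [of N M e K k]) (auto simp: K_def d)
      then show ?thesis
        using assms(1) by (intro that [of e k]) (simp_all add: K_def d)
    qed
    have r: "claim (r + d * t) N" if "t \<le> T" for t
      using that
    proof (induction t)
      case 0
      then show ?case using rT by simp
    next
      case (Suc t)
      \<comment> \<open>As c + 1 = T - t <= k + 1, the hypothesis at N + 1 covers d (c + 1).\<close>
      define c where "c = T - Suc t"
      have "T = t + Suc c"
        using Suc.prems by (simp add: c_def)
      then have K: "K = (r + d * t) + d * Suc c"
        using rT(1) by (simp add: algebra_simps)
      have "claim (d * Suc c) (Suc N)"
        using rT(2) \<open>T = t + Suc c\<close> by (intro IH) simp
      moreover have "claim (r + d * t) N"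
        using Suc by simp
      ultimately have "claim (r + d * t + d) N"
        using assms(1) False step.hyps K unfolding claim_def by (intro gordon_gf_odd_step)
      then show ?case by (simp add: algebra_simps)
    qed
    have "claim b N" if "b \<le> K" "d dvd K - b" for b
    proof -
      obtain t where t: "K - b = d * t"
        using \<open>d dvd K - b\<close> ..
      with that have bt: "b + d * t = r + d * T"
        using rT(1) by simp
      have "t \<le> T"
      proof (rule ccontr)
        assume "\<not> t \<le> T"
        then have "d * Suc T \<le> d * t"
          by (intro mult_le_mono2) simp
        with bt rT(4) show False by simp
      qed
      then have "b = r + d * (T - t)"
        using bt by (simp add: diff_mult_distrib2)
      with r [of "T - t"] show ?thesis by simp
    qed
    with False show ?thesis by simp
  qed
qed

section \<open>Passage to the infinite products\<close>

lemma fps_qpoch_inf_nth_0: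
  assumes "0 < p" "0 < r"
  shows "fps_qpoch_inf (fps_X ^ p) (fps_X ^ r) $ 0 = (1 :: 'a::field)"
  using fps_qpoch_inf_cong [OF assms, of 1 1] assms by (simp add: fps_cong_iff_nth qpoch_X_power_nth_0)

theorem theorem3p1:
  fixes a k d e :: nat
  assumes "1 \<le> a" "a \<le> k" "1 \<le> d" "d \<le> k" "e = d \<or> 2 * e = d"
  shows "Abs_fps (\<lambda>n. of_nat (dB d k e a n)) =
    (let q = (fps_X :: rat fps); m = 2 * d * k + 2 * e + d in
      fps_qpoch_inf (q ^ (d * a)) (q ^ m) * fps_qpoch_inf (q ^ (m - d * a)) (q ^ m)
        * fps_qpoch_inf (q ^ m) (q ^ m)
      / (fps_qpoch_inf (q ^ d) (q ^ (2 * d)) * fps_qpoch_inf (q ^ 2) (q ^ 2)))"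
proof -
  define K where "K = d * k + e"
  define m where "m = 2 * d * k + 2 * e + d"
  define b where "b = d * a"
  define G where "G = (gordon_gf K d 0 b :: rat fps)"
  define num where "num = (fps_qpoch_inf (fps_X ^ b) (fps_X ^ m) * fps_qpoch_inf (fps_X ^ (m - b)) (fps_X ^ m)
        * fps_qpoch_inf (fps_X ^ m) (fps_X ^ m) :: rat fps)"
  define den where "den = (fps_qpoch_inf (fps_X ^ d) (fps_X ^ (2 * d)) * fps_qpoch_inf (fps_X ^ 2) (fps_X ^ 2) :: rat fps)"
  have m: "m = 2 * K + d"
    by (simp add: m_def K_def)
  have "b \<le> d * k"
    unfolding b_def using assms(2) by (rule mult_le_mono2)
  moreover have "0 < b"
    using assms by (simp add: b_def)
  ultimately have b: "0 < b" "b \<le> K + d" "b < m" "0 < K" "0 < d" "0 < m"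
    using assms(1-3) by (simp_all add: m K_def)
  \<comment> \<open>Multiplied out, both sides can be compared through truncated products;
    \<open>den\<close> has constant term 1, so dividing by it afterwards is legitimate.\<close>
  have "G * den = num"
  proof (rule fps_eqI_cong)
    fix M
    have "fps_cong M (G * den)
        (G * (qpoch (fps_X ^ d) (fps_X ^ (2 * d)) M * qpoch (fps_X ^ 2) (fps_X ^ 2) M))"
      unfolding den_def using b by (intro fps_cong_mult fps_cong_refl fps_qpoch_inf_cong) auto
    also have "fps_cong M \<dots> (G * gordon_denominator d M 0)"
      using b by (intro fps_cong_mult fps_cong_refl fps_cong_sym [OF gordon_denominator_cong])
    also have "fps_cong M \<dots> (gordon_sum K d M b 0)"
      using gordon_gf_cong_gordon_sum [where 'a = rat, of d e 0 M k] assms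
      by (simp add: G_def K_def b_def)
    also have "fps_cong M \<dots> (qpoch (fps_X ^ b) (fps_X ^ m) M * qpoch (fps_X ^ (m - b)) (fps_X ^ m) M
      * qpoch (fps_X ^ m) (fps_X ^ m) M)"
      unfolding m using b by (intro gordon_sum_triple_product)
    also have "fps_cong M \<dots> num"
      unfolding num_def using b by (intro fps_cong_mult fps_cong_sym [OF fps_qpoch_inf_cong]) auto
    finally show "fps_cong M (G * den) num" .
  qed
  moreover have "den $ 0 \<noteq> 0"
    using b by (simp add: den_def fps_qpoch_inf_nth_0)
  then have "den \<noteq> 0" by auto
  ultimately have "G = num / den"
    by (metis nonzero_mult_div_cancel_right)
  moreover have "Abs_fps (\<lambda>n. of_nat (dB d k e a n)) = G"
    by (simp add: G_def gordon_gf_def dB_def dB_set_eq K_def b_def)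
  ultimately show ?thesis
    by (simp add: num_def den_def m_def b_def Let_def)
qed

end
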